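(* Let $k\ge 1$ and $n=p_1\cdots p_k$ with $p_1<\cdots<p_k$ odd primes. Then $g(\Phi_n)\ge \gamma^+(n)$ and $g(\Psi_n)\ge\gamma^-(n)$, where \[ \gamma^{+}(n)=\max_{\substack{1\le r<k\\ \rho(k-r)=-1}}\Bigl(p_1\cdots p_r-\sum_{\substack{d\mid n\\ \omega(d)<r}}\mu(n/d)\,d\Bigr),\qquad \gamma^{-}(n)=\max_{\substack{1\le r<k\\ \rho(k-r)=+1}}\Bigl(p_1\cdots p_r+\sum_{\substack{d\mid n\\ \omega(d)<r}}\mu(n/d)\,d\Bigr). \]
   Context: $\Phi_n(x)=\prod_{1\le j\le n,\ \gcd(j,n)=1}(x-e^{2\pi i j/n})$ is the $n$-th cyclotomic polynomial and $\Psi_n(x)=\prod_{1\le j\le n,\ \gcd(j,n)\ne1}(x-e^{2\pi i j/n})$ is the $n$-th inverse cyclotomic polynomial. For a polynomial $f=c_1x^{\nu_1}+\cdots+c_tx^{\nu_t}$ with all $c_i\ne0$ and $0\le\nu_1<\cdots<\nu_t$, the maximum gap is $g(f)=\max_{1\le i<t}(\nu_{i+1}-\nu_i)$ if $t\ne1$, and $g(f)=0$ if $t=1$. For square-free $d$, $\omega(d)$ is the number of prime factors of $d$ and $\mu(d)=(-1)^{\omega(d)}$. For an integer $i$, $\rho(i)=(-1)^i$. *)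

theory Defs
  imports Complex_Main
    "HOL-Computational_Algebra.Computational_Algebra"
begin

definition cyclotomic :: "nat \<Rightarrow> complex poly" where
  "cyclotomic n =
     (\<Prod>j | 1 \<le> j \<and> j \<le> n \<and> gcd j n = 1.
        [:- exp (2 * of_real pi * \<i> * of_nat j / of_nat n), 1:])"

definition inverse_cyclotomic :: "nat \<Rightarrow> complex poly" where
  "inverse_cyclotomic n =
     (\<Prod>j | 1 \<le> j \<and> j \<le> n \<and> gcd j n \<noteq> 1.
        [:- exp (2 * of_real pi * \<i> * of_nat j / of_nat n), 1:])"

definition exponents :: "'a::zero poly \<Rightarrow> nat list" where
  "exponents f = sorted_list_of_set {i. coeff f i \<noteq> 0}"

(* The zero polynomial, which has no terms at all, also gets the value 0. *)
definition max_gap :: "'a::zero poly \<Rightarrow> nat" where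
  "max_gap f =
     (if length (exponents f) \<le> 1 then 0
      else Max {exponents f ! Suc i - exponents f ! i | i. Suc i < length (exponents f)})"

definition omega :: "nat \<Rightarrow> nat" where
  "omega d = card (prime_factors d)"

definition mu :: "nat \<Rightarrow> int" where
  "mu d = (if squarefree d then (-1) ^ omega d else 0)"

definition rho :: "int \<Rightarrow> int" where
  "rho i = (if even i then 1 else -1)"

(* The empty maximum, which occurs for small k, is read as 0. *)
definition max_or_zero :: "int set \<Rightarrow> int" where
  "max_or_zero A = (if A = {} then 0 else Max A)"

(* p 1 < ... < p k are the prime factors of n, in increasing order. *)
definition gamma_plus :: "(nat \<Rightarrow> nat) \<Rightarrow> nat \<Rightarrow> nat \<Rightarrow> int" where
  "gamma_plus p k n =
     max_or_zero {int (\<Prod>i=1..r. p i) - (\<Sum>d | d dvd n \<and> omega d < r. mu (n div d) * int d)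
                  | r. 1 \<le> r \<and> r < k \<and> rho (int k - int r) = -1}"

definition gamma_minus :: "(nat \<Rightarrow> nat) \<Rightarrow> nat \<Rightarrow> nat \<Rightarrow> int" where
  "gamma_minus p k n =
     max_or_zero {int (\<Prod>i=1..r. p i) + (\<Sum>d | d dvd n \<and> omega d < r. mu (n div d) * int d)
                  | r. 1 \<le> r \<and> r < k \<and> rho (int k - int r) = 1}"

end

theory Submission imports Defs begin

text \<open>Moebius inversion writes \<open>\<Phi>\<^sub>n\<close> as the product of the \<open>(x^d - 1)^\<mu>(n/d)\<close> over the divisors
  \<open>d\<close> of \<open>n\<close>, and \<open>\<Psi>\<^sub>n = (x^n - 1) / \<Phi>\<^sub>n\<close>. The factors with \<open>\<omega>(d) < r\<close> multiply to a polynomial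
  \<open>A\<close>: the multiplicity of a root of unity in \<open>A\<close> is a truncated alternating sum of binomial
  coefficients, whose sign is controlled by the parity of \<open>k - r\<close>. Every other \<open>d\<close> is at least
  \<open>m = p\<^sub>1 \<cdots> p\<^sub>r\<close>, and \<open>x^m - 1\<close> occurs with exponent \<open>-1\<close>, so up to sign the polynomial in question is
  \<open>A * (1 + x^m)\<close> modulo \<open>x^(m+1)\<close>. If \<open>degree A < m\<close>, the exponents \<open>degree A\<close> and \<open>m\<close>
  are therefore consecutive, and \<open>degree A\<close> is the (signed) divisor sum in the bound.\<close>

section \<open>Gaps in quotients of products of the polynomials \<open>x^d - 1\<close>\<close>

lemma max_gap_ge:
  fixes f :: "'a::zero poly"
  assumes "a < b" "coeff f a \<noteq> 0" "coeff f b \<noteq> 0"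
    and "\<And>i. a < i \<Longrightarrow> i < b \<Longrightarrow> coeff f i = 0"
  shows "b - a \<le> max_gap f"
proof -
  define S where "S = {i. coeff f i \<noteq> 0}"
  define xs where "xs = exponents f"
  have fin: "finite S"
    by (rule finite_subset[of _ "{..degree f}"]) (auto simp: S_def intro: le_degree)
  have set: "set xs = S" and sorted: "sorted_wrt (<) xs"
    using fin by (simp_all add: xs_def exponents_def flip: S_def)
  have "a \<in> set xs" "b \<in> set xs"
    using assms(2,3) by (simp_all add: set S_def)
  obtain i where i: "i < length xs" "xs ! i = a"
    using \<open>a \<in> set xs\<close> by (auto simp: in_set_conv_nth)
  obtain j where j: "j < length xs" "xs ! j = b"
    using \<open>b \<in> set xs\<close> by (auto simp: in_set_conv_nth)
  have "i < j"
    using sorted_wrt_nth_less[OF sorted, of j i] i j assms(1) by (cases i j rule: linorder_cases) auto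
  hence "Suc i < length xs" using j by simp
  hence "a < xs ! Suc i" using sorted_wrt_nth_less[OF sorted, of i "Suc i"] i by simp
  moreover have "coeff f (xs ! Suc i) \<noteq> 0"
    using nth_mem[OF \<open>Suc i < length xs\<close>] set by (simp add: S_def)
  \<comment> \<open>The next exponent need not be identified with \<open>b\<close>: a lower bound on
    it already bounds the gap that starts at \<open>a\<close>.\<close>
  ultimately have "b \<le> xs ! Suc i" using assms(4)[of "xs ! Suc i"] by force
  let ?G = "{xs ! Suc i - xs ! i | i. Suc i < length xs}"
  have "finite ?G"
    by (rule finite_subset[of _ "(\<lambda>i. xs ! Suc i - xs ! i) ` {..<length xs}"]) auto
  hence "xs ! Suc i - xs ! i \<le> Max ?G"
    using \<open>Suc i < length xs\<close> by (intro Max_ge) auto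
  moreover have "max_gap f = Max ?G"
    using \<open>Suc i < length xs\<close> by (auto simp: max_gap_def xs_def)
  ultimately show ?thesis using \<open>b \<le> xs ! Suc i\<close> i by simp
qed

text \<open>At \<open>d = 0\<close> this is the zero polynomial, hence the positivity assumptions
  wherever a product of these is cancelled.\<close>

definition unity_poly :: "nat \<Rightarrow> complex poly" where
  "unity_poly d = monom 1 d - 1"

lemma coeff_mult_unity_poly:
  "coeff (f * unity_poly d) i = (if d \<le> i then coeff f (i - d) else 0) - coeff f i"
  using coeff_monom_mult[of 1 d f i] by (simp add: unity_poly_def algebra_simps not_less)

lemma unity_poly_nz: "d > 0 \<Longrightarrow> unity_poly d \<noteq> 0"
  using coeff_mult_unity_poly[of 1 d 0] by auto

lemma degree_unity_poly: "degree (unity_poly d) = d"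
proof (rule antisym)
  show "degree (unity_poly d) \<le> d"
    unfolding unity_poly_def by (intro degree_diff_le) (auto simp: degree_monom_le)
  show "d \<le> degree (unity_poly d)"
    by (cases "d = 0") (auto simp: unity_poly_def intro!: le_degree)
qed

lemma degree_prod_unity_poly:
  assumes "\<And>d. d \<in> D \<Longrightarrow> d > 0"
  shows "degree (prod unity_poly D) = \<Sum>D"
  using assms by (subst degree_prod_sum_eq) (auto simp: degree_unity_poly unity_poly_nz)

text \<open>Modulo \<open>x^(i+1)\<close> each factor \<open>x^d - 1\<close> with
  \<open>d > i\<close> is just \<open>-1\<close>.\<close>

lemma coeff_mult_prod_unity_poly:
  assumes "finite D" "\<And>d. d \<in> D \<Longrightarrow> i < d"
  shows "coeff (f * prod unity_poly D) i = (-1) ^ card D * coeff f i"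
  using assms
proof (induction D arbitrary: f rule: finite_induct)
  case (insert d D)
  have "coeff (f * prod unity_poly (insert d D)) i = coeff ((f * unity_poly d) * prod unity_poly D) i"
    using insert by (simp add: mult_ac)
  also have "\<dots> = (-1) ^ card D * coeff (f * unity_poly d) i"
    using insert by simp
  also have "coeff (f * unity_poly d) i = - coeff f i"
    using insert.prems(1)[of d] by (simp add: coeff_mult_unity_poly)
  finally show ?case using insert by simp
qed simp

text \<open>Here \<open>A\<close> is the quotient of the products over \<open>X\<close> and \<open>Y\<close>; cancelling the latter leaves
  \<open>F * (x^m - 1) = \<plusminus>A\<close> modulo \<open>x^(m+1)\<close>.\<close>
lemma max_gap_ge_of_unity_poly_quotient:
  assumes fin: "finite X" "finite Y" "finite X'" "finite Y'"
    and pos: "m > 0" "\<And>d. d \<in> X \<union> Y \<Longrightarrow> d > 0"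
    and big: "\<And>d. d \<in> X' \<union> Y' \<Longrightarrow> m < d"
    and dvd: "prod unity_poly Y dvd prod unity_poly X"
    and eq: "F * (prod unity_poly Y * (unity_poly m * prod unity_poly Y'))
               = prod unity_poly X * prod unity_poly X'"
  shows "int m - (int (\<Sum>X) - int (\<Sum>Y)) \<le> int (max_gap F)"
proof -
  obtain A where A: "prod unity_poly X = prod unity_poly Y * A"
    using dvd by blast
  have nzX: "prod unity_poly X \<noteq> 0" and nzY: "prod unity_poly Y \<noteq> 0"
    using fin pos(2) unity_poly_nz by auto
  have A0: "A \<noteq> 0" using A nzX by auto
  have deg: "\<Sum>X = \<Sum>Y + degree A"
    using arg_cong[OF A, of degree] nzY A0 pos(2)
    by (simp add: degree_mult_eq degree_prod_unity_poly)
  show ?thesis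
  \<comment> \<open>If \<open>degree A\<close> is at least \<open>m\<close>, the claimed lower bound
    is at most 0.\<close>
  proof (cases "degree A < m")
    case True
    have "prod unity_poly Y * (F * unity_poly m * prod unity_poly Y') = prod unity_poly Y * (A * prod unity_poly X')"
      using eq A by (simp add: mult_ac)
    hence eq': "F * unity_poly m * prod unity_poly Y' = A * prod unity_poly X'"
      using nzY by simp
    define s t :: complex where "s = (-1) ^ card Y'" and "t = (-1) ^ card X'"
    have st: "s \<noteq> 0" "t \<noteq> 0" by (simp_all add: s_def t_def)
    \<comment> \<open>Up to degree \<open>m\<close> the factors over \<open>X'\<close> and
      \<open>Y'\<close> only contribute signs. Below \<open>m\<close> this makes \<open>F\<close>
      and \<open>A\<close> vanish at the same exponents; at \<open>m\<close> the constant
      coefficient of \<open>F\<close> enters as well.\<close>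
    have co: "s * ((if m \<le> i then coeff F (i - m) else 0) - coeff F i) = t * coeff A i" if "i \<le> m" for i
    proof -
      have "\<And>d. d \<in> X' \<union> Y' \<Longrightarrow> i < d" using big that by fastforce
      hence "s * coeff (F * unity_poly m) i = t * coeff A i"
        using arg_cong[OF eq', of "\<lambda>q. coeff q i"] fin
        by (simp add: coeff_mult_prod_unity_poly s_def t_def)
      thus ?thesis by (simp add: coeff_mult_unity_poly)
    qed
    have low: "coeff F i = 0 \<longleftrightarrow> coeff A i = 0" if "i < m" for i
      using co[of i] that st by auto
    \<comment> \<open>Since 0 is not a root, \<open>A\<close> and hence \<open>F\<close> have
      nonzero constant coefficient. As \<open>A\<close> has no term at \<open>m\<close>, the
      coefficient of \<open>F\<close> at \<open>m\<close> equals the one at 0.\<close>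
    have "poly (prod unity_poly X) 0 \<noteq> 0"
      using fin pos(2) by (auto simp: poly_prod unity_poly_def poly_monom zero_power)
    hence "coeff A 0 \<noteq> 0"
      by (auto simp: A poly_0_coeff_0 coeff_mult)
    hence "coeff F 0 \<noteq> 0" using low pos by blast
    moreover have "coeff A m = 0" using True by (simp add: coeff_eq_0)
    ultimately have "coeff F m \<noteq> 0" using co[of m] st by auto
    moreover have "coeff F (degree A) \<noteq> 0" using low True A0 by auto
    ultimately have "m - degree A \<le> max_gap F"
      using True low by (intro max_gap_ge) (auto simp: coeff_eq_0)
    thus ?thesis using deg by simp
  qed (use deg in simp)
qed

section \<open>Factorisation over the n-th roots of unity\<close>

abbreviation root_factor :: "nat \<Rightarrow> nat \<Rightarrow> complex poly" where
  "root_factor n j \<equiv> [:- exp (2 * of_real pi * \<i> * of_nat j / of_nat n), 1:]"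

lemma unity_poly_eq_prod:
  assumes "n > 0"
  shows "unity_poly n = (\<Prod>j\<in>{1..n}. root_factor n j)"
proof -
  \<comment> \<open>The derivative \<open>n * x^(n-1)\<close> can vanish only at 0, which is not a
    root.\<close>
  have rs: "rsquarefree (unity_poly n)"
    using assms by (auto simp: rsquarefree_roots unity_poly_def pderiv_diff pderiv_monom poly_monom zero_power)
  have lead: "lead_coeff (unity_poly n) = 1"
    using assms by (simp add: degree_unity_poly) (simp add: unity_poly_def)
  define e where "e j = exp (2 * of_real pi * \<i> * of_nat j / of_nat n)" for j
  have cis: "e j = cis (2 * pi * real j / real n)" for j
    by (simp add: e_def cis_conv_exp mult_ac)
  have "bij_betw e {..<n} {z. z ^ n = 1}"
    using bij_betw_roots_unity[OF assms] by (simp add: cis[abs_def])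
  moreover have "{z. poly (unity_poly n) z = 0} = {z. z ^ n = 1}"
    by (auto simp: unity_poly_def poly_monom)
  ultimately have bij: "bij_betw e {..<n} {z. poly (unity_poly n) z = 0}" by simp
  have "unity_poly n = (\<Prod>z | poly (unity_poly n) z = 0. [:- z, 1:])"
    using complex_poly_decompose_rsquarefree[OF rs] lead by simp
  also have "\<dots> = (\<Prod>j<n. [:- e j, 1:])"
    by (rule prod.reindex_bij_betw[OF bij, symmetric])
  \<comment> \<open>The indices 0 and \<open>n\<close> give the same root 1, so the range can be
    shifted to the one in the definitions.\<close>
  also have "\<dots> = (\<Prod>j\<in>{1..n}. [:- e j, 1:])"
  proof -
    have "e n = e 0" using assms by (simp add: cis)
    have "{..<n} = insert 0 {1..<n}" "{1..n} = insert n {1..<n}" using assms by auto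
    thus ?thesis using \<open>e n = e 0\<close> by simp
  qed
  finally show ?thesis by (simp add: e_def)
qed

text \<open>Indexing the \<open>d\<close>-th roots of unity by \<open>j \<in> {1..n}\<close> puts all products over divisors of \<open>n\<close> in
  terms of the same linear factors, so that they can be compared exponent by exponent.\<close>
lemma unity_poly_divisor_eq_prod:
  assumes "n > 0" "d dvd n"
  shows "unity_poly d = (\<Prod>j | j \<in> {1..n} \<and> n div d dvd j. root_factor n j)"
proof -
  obtain c where c: "n = d * c" using assms by blast
  have pos: "d > 0" "c > 0" using assms c by auto
  have "(\<Prod>j | j \<in> {1..n} \<and> n div d dvd j. root_factor n j) = (\<Prod>i\<in>{1..d}. root_factor d i)"
    by (rule prod.reindex_bij_witness[of _ "\<lambda>i. c * i" "\<lambda>j. j div c"])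
       (use pos c in \<open>auto simp: field_simps\<close>)
  thus ?thesis using unity_poly_eq_prod pos by simp
qed

text \<open>After the two products are swapped, the exponent counts the \<open>d\<close> in
  \<open>D\<close> for which \<open>exp (2 pi i j / n)\<close> is a d-th root of unity.\<close>

lemma prod_unity_poly_divisors:
  assumes "n > 0" "\<And>d. d \<in> D \<Longrightarrow> d dvd n"
  shows "prod unity_poly D = (\<Prod>j\<in>{1..n}. root_factor n j ^ card {d \<in> D. n div d dvd j})"
proof -
  have fin: "finite D" using assms by (meson dvd_imp_le finite_nat_set_iff_bounded_le)
  have "prod unity_poly D = (\<Prod>d\<in>D. \<Prod>j\<in>{1..n}. if n div d dvd j then root_factor n j else 1)"
    by (intro prod.cong refl)
       (simp only: unity_poly_divisor_eq_prod[OF assms(1) assms(2)] prod.inter_filter[OF finite_atLeastAtMost])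
  also have "\<dots> = (\<Prod>j\<in>{1..n}. \<Prod>d\<in>D. if n div d dvd j then root_factor n j else 1)"
    by (rule prod.swap)
  also have "\<dots> = (\<Prod>j\<in>{1..n}. root_factor n j ^ card {d \<in> D. n div d dvd j})"
    using fin by (intro prod.cong) (simp_all add: prod.inter_filter[symmetric])
  finally show ?thesis .
qed

section \<open>Divisors of square-free numbers and truncated Moebius sums\<close>

lemma squarefree_pos: "squarefree (n :: nat) \<Longrightarrow> n > 0"
  by (cases n) auto

lemma squarefree_prod_prime_factors:
  fixes c :: nat
  assumes "squarefree c"
  shows "\<Prod>(prime_factors c) = c"
proof -
  have nz: "c \<noteq> 0" using squarefree_pos[OF assms] by simp
  hence "\<And>q. q \<in> prime_factors c \<Longrightarrow> multiplicity q c = 1"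
    using assms squarefree_factorial_semiring' by blast
  thus ?thesis using prod_prime_factors[OF nz] by simp
qed

lemma prime_factors_prod_primes:
  fixes I :: "nat set"
  assumes "finite I" "\<And>q. q \<in> I \<Longrightarrow> prime q"
  shows "prime_factors (\<Prod>I) = I"
proof -
  have "0 \<notin> id ` I" using assms(2)[of 0] by auto
  hence "prime_factors (prod id I) = (\<Union>q\<in>I. prime_factors q)"
    using prime_factors_prod[OF assms(1), of id] by (simp add: comp_def)
  also have "\<dots> = (\<Union>q\<in>I. {q})"
    using assms(2) by (intro SUP_cong refl prime_prime_factors)
  finally show ?thesis by (simp add: id_def)
qed

text \<open>Divisors become sets of primes, with the product as inverse map. This turns
  \<open>omega\<close> into cardinality and sums over divisors into binomial sums.\<close>

lemma bij_betw_prime_factors_divisors: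
  fixes g :: nat
  assumes "squarefree g"
  shows "bij_betw prime_factors {c. c dvd g} (Pow (prime_factors g))"
proof (rule bij_betw_byWitness[of _ Prod])
  have nz: "g \<noteq> 0" using squarefree_pos[OF assms] by simp
  show "\<forall>c\<in>{c. c dvd g}. \<Prod>(prime_factors c) = c"
    using assms squarefree_mono squarefree_prod_prime_factors by blast
  show "\<forall>I\<in>Pow (prime_factors g). prime_factors (\<Prod>I) = I"
    by (auto intro!: prime_factors_prod_primes intro: finite_subset)
  show "prime_factors ` {c. c dvd g} \<subseteq> Pow (prime_factors g)"
    using nz dvd_prime_factors by blast
  show "Prod ` Pow (prime_factors g) \<subseteq> {c. c dvd g}"
  proof clarsimp
    fix I assume "I \<subseteq> prime_factors g"
    hence "\<Prod>I dvd \<Prod>(prime_factors g)" by (intro prod_dvd_prod_subset) auto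
    thus "\<Prod>I dvd g" using squarefree_prod_prime_factors[OF assms] by simp
  qed
qed

lemma sum_omega_divisors:
  fixes f :: "nat \<Rightarrow> 'a::semiring_1"
  assumes "squarefree g"
  shows "(\<Sum>c | c dvd g. f (omega c)) = (\<Sum>i\<le>omega g. of_nat (omega g choose i) * f i)"
proof -
  let ?P = "prime_factors g"
  have "(\<Sum>c | c dvd g. f (omega c)) = (\<Sum>I\<in>Pow ?P. f (card I))"
    unfolding omega_def
    by (rule sum.reindex_bij_betw[OF bij_betw_prime_factors_divisors[OF assms]])
  also have "\<dots> = (\<Sum>i\<le>card ?P. \<Sum>I | I \<in> Pow ?P \<and> card I = i. f (card I))"
    by (rule sum.group[symmetric]) (auto intro: card_mono)
  also have "\<dots> = (\<Sum>i\<le>card ?P. of_nat (card ?P choose i) * f i)"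
    by (intro sum.cong) (simp_all add: n_subsets flip: Pow_def)
  finally show ?thesis by (simp add: omega_def)
qed

lemma omega_eq_0_iff: "c > 0 \<Longrightarrow> omega c = 0 \<longleftrightarrow> c = 1"
  by (auto simp: omega_def prime_factorization_empty_iff)

text \<open>At \<open>N = t\<close> every summand is 0 and the right-hand terms cancel. Pascal's
  rule splits each new summand into a part cancelling the previous last term and the new last
  term.\<close>

lemma alternating_binomial_sum_tail:
  "t \<le> N \<Longrightarrow> (\<Sum>i\<le>N. int (Suc v choose i) * (if t < i then (-1) ^ i else 0))
     = (-1) ^ Suc t * int (v choose t) + (-1) ^ N * int (v choose N)"
proof (induction N rule: dec_induct)
  case base
  show ?case by (auto intro!: sum.neutral)
qed (simp add: algebra_simps)

text \<open>This is the binomial tail up to \<open>omega g\<close>, where its last term vanishes.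
  The sign depends on \<open>t\<close> alone and not on \<open>g\<close>, so the multiplicities of
  all roots can be compared at once.\<close>

lemma sum_mu_omega_gt:
  assumes "squarefree g" "g \<noteq> 1"
  shows "(\<Sum>c | c dvd g \<and> t < omega c. mu c) = (-1) ^ Suc t * int (omega g - 1 choose t)"
proof -
  have pos: "g > 0" using assms(1) by (rule squarefree_pos)
  then obtain v where v: "omega g = Suc v"
    using omega_eq_0_iff assms(2) by (metis not0_implies_Suc)
  have "(\<Sum>c | c dvd g \<and> t < omega c. mu c) = (\<Sum>c | c \<in> {c. c dvd g} \<and> t < omega c. mu c)"
    by simp
  also have "\<dots> = (\<Sum>c | c dvd g. if t < omega c then mu c else 0)"
    using pos by (intro sum.inter_filter) simp
  also have "\<dots> = (\<Sum>c | c dvd g. if t < omega c then (-1) ^ omega c else 0)"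
    using assms(1) by (intro sum.cong) (auto simp: mu_def dest: squarefree_mono)
  also have "\<dots> = (\<Sum>i\<le>Suc v. int (Suc v choose i) * (if t < i then (-1) ^ i else 0))"
    using sum_omega_divisors[OF assms(1), of "\<lambda>i. if t < i then (-1) ^ i else 0 :: int"] v by simp
  also have "\<dots> = (-1) ^ Suc t * int (v choose t)"
  \<comment> \<open>For larger \<open>t\<close> all summands and the binomial coefficient are
    0.\<close>
  proof (cases "t \<le> Suc v")
    case True
    thus ?thesis using alternating_binomial_sum_tail[of t "Suc v" v] by simp
  qed (auto intro!: sum.neutral)
  finally show ?thesis by (simp add: v)
qed

lemma sum_mu_divisors:
  assumes "squarefree g"
  shows "(\<Sum>c | c dvd g. mu c) = (if g = 1 then 1 else 0)"
proof -
  have pos: "g > 0" using assms squarefree_pos by blast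
  have "(\<Sum>c | c dvd g. mu c) = (\<Sum>c | c dvd g. (-1) ^ omega c)"
    using assms by (intro sum.cong) (auto simp: mu_def dest: squarefree_mono)
  also have "\<dots> = (\<Sum>i\<le>omega g. (-1) ^ i * int (omega g choose i))"
    using sum_omega_divisors[OF assms, of "\<lambda>i. (-1) ^ i :: int"] by (simp add: mult.commute)
  also have "\<dots> = (if g = 1 then 1 else 0)"
  proof (cases "g = 1")
    case False
    hence "omega g > 0" using omega_eq_0_iff[OF pos] by simp
    thus ?thesis using choose_alternating_sum[of "omega g", where ?'a = int] False by simp
  qed (simp add: omega_def)
  finally show ?thesis .
qed

lemma omega_divisor_complement:
  assumes "squarefree n" "d dvd n"
  shows "omega d + omega (n div d) = omega n"
proof -
  obtain c where c: "n = d * c" using assms by blast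
  have nz: "d \<noteq> 0" "c \<noteq> 0" using squarefree_pos[OF assms(1)] c by auto
  have "prime_factors d \<inter> prime_factors c = {}"
  proof (rule ccontr)
    assume "prime_factors d \<inter> prime_factors c \<noteq> {}"
    then obtain q where "prime q" "q dvd d" "q dvd c" by auto
    hence "q\<^sup>2 dvd n" by (simp add: c power2_eq_square mult_dvd_mono)
    thus False using assms(1) \<open>prime q\<close> squarefreeD by (metis not_prime_unit)
  qed
  thus ?thesis using nz by (simp add: c omega_def prime_factors_product card_Un_disjoint)
qed

text \<open>Applied with \<open>w = 1\<close> to multiplicities of roots and with
  \<open>w d = d\<close> to degrees.\<close>

lemma sum_signed_split:
  fixes f w :: "'a \<Rightarrow> int"
  assumes "finite E" "\<And>d. d \<in> E \<Longrightarrow> f d = 1 \<or> f d = -1" "s = 1 \<or> s = -1"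
  shows "s * (\<Sum>d\<in>E. f d * w d) = (\<Sum>d | d \<in> E \<and> f d = s. w d) - (\<Sum>d | d \<in> E \<and> f d = -s. w d)"
proof -
  have "(\<Sum>d | d \<in> E \<and> f d = s. w d) - (\<Sum>d | d \<in> E \<and> f d = -s. w d)
      = (\<Sum>d\<in>E. (if f d = s then w d else 0) - (if f d = -s then w d else 0))"
    using assms(1) by (simp add: sum.inter_filter sum_subtractf)
  also have "\<dots> = (\<Sum>d\<in>E. s * (f d * w d))"
    using assms(3) by (intro sum.cong refl) (drule assms(2), auto)
  finally show ?thesis by (simp add: sum_distrib_left)
qed

section \<open>Cyclotomic and inverse cyclotomic polynomials as quotients\<close>

text \<open>Class 1 is the numerator and class -1 the denominator of the cyclotomic polynomial; for
  the inverse one they trade places. The parameter \<open>s\<close> lets one argument serve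
  both.\<close>

definition mu_class :: "nat \<Rightarrow> int \<Rightarrow> nat set" where
  "mu_class n s = {d. d dvd n \<and> mu (n div d) = s}"

lemma mu_divisor_cases:
  assumes "squarefree n" "d dvd n"
  shows "mu (n div d) = 1 \<or> mu (n div d) = -1"
proof -
  have "squarefree (n div d)" using assms squarefree_mono by (metis dvd_div_mult_self dvd_triv_left)
  thus ?thesis by (cases "even (omega (n div d))") (simp_all add: mu_def)
qed

text \<open>The two cardinalities are multiplicities of \<open>root_factor n j\<close>, with
  \<open>P\<close> selecting the divisors kept. Substituting \<open>c = n div d\<close> turns the
  conditions on \<open>d\<close> into \<open>c dvd gcd j n\<close>.\<close>

lemma card_mu_class_diff:
  assumes "squarefree n" "s = 1 \<or> s = -1"
  shows "int (card {d. d \<in> mu_class n s \<and> P (n div d) \<and> n div d dvd j})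
       - int (card {d. d \<in> mu_class n (-s) \<and> P (n div d) \<and> n div d dvd j})
       = s * (\<Sum>c | c dvd gcd j n \<and> P c. mu c)"
proof -
  have pos: "n > 0" using assms squarefree_pos by blast
  let ?E = "{d. d dvd n \<and> P (n div d) \<and> n div d dvd j}"
  have "finite ?E" by (rule finite_subset[of _ "{d. d dvd n}"]) (use pos in auto)
  hence "s * (\<Sum>d\<in>?E. mu (n div d) * 1)
      = (\<Sum>d | d \<in> ?E \<and> mu (n div d) = s. 1) - (\<Sum>d | d \<in> ?E \<and> mu (n div d) = - s. 1)"
    using assms mu_divisor_cases by (intro sum_signed_split) auto
  moreover have "{d. d \<in> mu_class n u \<and> P (n div d) \<and> n div d dvd j} = {d. d \<in> ?E \<and> mu (n div d) = u}" for u
    by (auto simp: mu_class_def)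
  moreover have "(\<Sum>d\<in>?E. mu (n div d)) = (\<Sum>c | c dvd gcd j n \<and> P c. mu c)"
    by (rule sum.reindex_bij_witness[of _ "\<lambda>c. n div c" "\<lambda>d. n div d"]) (use pos in auto)
  ultimately show ?thesis by simp
qed

text \<open>By the full Moebius sum over the divisors of \<open>gcd j n\<close>, the multiplicities
  in numerator and denominator differ by 1 at primitive roots and by 0 elsewhere.\<close>

lemma cyclotomic_unity_poly:
  assumes "squarefree n"
  shows "cyclotomic n * prod unity_poly (mu_class n (-1)) = prod unity_poly (mu_class n 1)"
proof -
  have pos: "n > 0" using assms squarefree_pos by blast
  have sq: "squarefree (gcd j n)" for j using assms squarefree_mono by (meson gcd_dvd2)
  have "cyclotomic n = (\<Prod>j | j \<in> {1..n} \<and> gcd j n = 1. root_factor n j)"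
    unfolding cyclotomic_def by (intro prod.cong) auto
  also have "\<dots> = (\<Prod>j\<in>{1..n}. root_factor n j ^ (if gcd j n = 1 then 1 else 0))"
    by (subst prod.inter_filter) (auto intro!: prod.cong)
  finally have cyc: "cyclotomic n = (\<Prod>j\<in>{1..n}. root_factor n j ^ (if gcd j n = 1 then 1 else 0))" .
  have "(if gcd j n = 1 then 1 else 0) + card {d \<in> mu_class n (-1). n div d dvd j}
      = card {d \<in> mu_class n 1. n div d dvd j}" for j
    using card_mu_class_diff[OF assms, of 1 "\<lambda>_. True" j] sum_mu_divisors[OF sq[of j]]
    by (simp split: if_splits)
  thus ?thesis
    using prod_unity_poly_divisors[OF pos, of "mu_class n 1"]
      prod_unity_poly_divisors[OF pos, of "mu_class n (-1)"]
    by (simp add: cyc mu_class_def power_add prod.distrib[symmetric] flip: power_add)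
qed

lemma cyclotomic_mult_inverse_cyclotomic:
  assumes "n > 0"
  shows "cyclotomic n * inverse_cyclotomic n = unity_poly n"
proof -
  have "unity_poly n = (\<Prod>j\<in>{1..n}. root_factor n j)" by (rule unity_poly_eq_prod[OF assms])
  also have "{1..n} = {j. 1 \<le> j \<and> j \<le> n \<and> gcd j n = 1} \<union> {j. 1 \<le> j \<and> j \<le> n \<and> gcd j n \<noteq> 1}" by auto
  also have "(\<Prod>j\<in>\<dots>. root_factor n j) = cyclotomic n * inverse_cyclotomic n"
    unfolding cyclotomic_def inverse_cyclotomic_def by (intro prod.union_disjoint) auto
  finally show ?thesis ..
qed

lemma finite_mu_class: "n > 0 \<Longrightarrow> finite (mu_class n s)"
  by (rule finite_subset[of _ "{d. d dvd n}"]) (auto simp: mu_class_def)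

text \<open>The factor for \<open>d = n\<close> lies in class 1 and cancels against the product of
  the two polynomials, which is \<open>x^n - 1\<close>.\<close>

lemma inverse_cyclotomic_unity_poly:
  assumes "squarefree n"
  shows "inverse_cyclotomic n * prod unity_poly (mu_class n 1 - {n}) = prod unity_poly (mu_class n (-1))"
proof -
  have pos: "n > 0" using assms squarefree_pos by blast
  have "n \<in> mu_class n 1" using pos by (simp add: mu_class_def mu_def omega_def)
  hence split: "prod unity_poly (mu_class n 1) = unity_poly n * prod unity_poly (mu_class n 1 - {n})"
    by (intro prod.remove finite_mu_class pos)
  have "unity_poly n * prod unity_poly (mu_class n (-1))
      = inverse_cyclotomic n * (cyclotomic n * prod unity_poly (mu_class n (-1)))"
    by (simp add: mult_ac flip: cyclotomic_mult_inverse_cyclotomic[OF pos])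
  also have "\<dots> = unity_poly n * (inverse_cyclotomic n * prod unity_poly (mu_class n 1 - {n}))"
    by (simp add: cyclotomic_unity_poly[OF assms] split)
  finally show ?thesis using unity_poly_nz[OF pos] by simp
qed

section \<open>Truncation to divisors with fewer than \<open>r\<close> prime factors\<close>

text \<open>In terms of \<open>n div d\<close> the cut-off reads
  \<open>omega (n div d) > omega n - r\<close>, so the multiplicities differ by a signed binomial
  coefficient. The parity hypothesis is exactly what makes that sign positive.\<close>

lemma low_unity_poly_dvd:
  assumes "squarefree n" "s = 1 \<or> s = -1" "r < omega n" "(-1) ^ (omega n - r) = - s"
  shows "prod unity_poly {d \<in> mu_class n (-s). omega d < r} dvd prod unity_poly {d \<in> mu_class n s. omega d < r}"
proof -
  have pos: "n > 0" using assms squarefree_pos by blast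
  have sq: "squarefree (gcd j n)" for j using assms squarefree_mono by (meson gcd_dvd2)
  define t where "t = omega n - r"
  have low: "omega d < r \<longleftrightarrow> t < omega (n div d)" if "d dvd n" for d
    using omega_divisor_complement[OF assms(1) that] assms(3) by (auto simp: t_def)
  have set: "{d \<in> {d \<in> mu_class n u. omega d < r}. n div d dvd j}
      = {d. d \<in> mu_class n u \<and> t < omega (n div d) \<and> n div d dvd j}" for u j
    using low by (auto simp: mu_class_def)
  have card: "card {d \<in> {d \<in> mu_class n (-s). omega d < r}. n div d dvd j}
      \<le> card {d \<in> {d \<in> mu_class n s. omega d < r}. n div d dvd j}" for j
  proof -
    have "0 \<le> s * (\<Sum>c | c dvd gcd j n \<and> t < omega c. mu c)"
    \<comment> \<open>At a primitive root the only candidate is \<open>c = 1\<close>, and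
      \<open>omega 1 = 0\<close> fails the cut-off.\<close>
    proof (cases "gcd j n = 1")
      case True
      have "{c. c dvd gcd j n \<and> t < omega c} = {}" by (auto simp: True omega_def)
      thus ?thesis by (metis mult_zero_right order_refl sum.empty)
    next
      case False
      have "s * (-1) ^ Suc t = 1" using assms(2,4) by (auto simp: t_def)
      thus ?thesis unfolding sum_mu_omega_gt[OF sq False] by (metis mult.assoc mult_1 of_nat_0_le_iff)
    qed
    thus ?thesis
      using card_mu_class_diff[OF assms(1,2), of "\<lambda>c. t < omega c" j] unfolding set by linarith
  qed
  have "prod unity_poly {d \<in> mu_class n u. omega d < r}
      = (\<Prod>j\<in>{1..n}. root_factor n j ^ card {d \<in> {d \<in> mu_class n u. omega d < r}. n div d dvd j})" for u
    by (rule prod_unity_poly_divisors[OF pos]) (simp add: mu_class_def)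
  thus ?thesis using card by (simp only:) (intro prod_dvd_prod le_imp_power_dvd)
qed

text \<open>Used with \<open>s = 1\<close> for the cyclotomic and \<open>s = -1\<close> for the
  inverse cyclotomic polynomial. Removing \<open>n\<close> matters only in the second case, where
  \<open>x^n - 1\<close> has been cancelled.\<close>

lemma max_gap_ge_truncated:
  assumes sq: "squarefree n" and s: "s = 1 \<or> s = -1"
    and r: "r < omega n" "(-1) ^ (omega n - r) = - s"
    and m: "m dvd n" "omega m = r" "\<And>d. d dvd n \<Longrightarrow> r \<le> omega d \<Longrightarrow> m \<le> d"
    and F: "F * prod unity_poly (mu_class n (-s) - {n}) = prod unity_poly (mu_class n s)"
  shows "int m - s * (\<Sum>d | d dvd n \<and> omega d < r. mu (n div d) * int d) \<le> int (max_gap F)"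
proof -
  have pos: "n > 0" using sq by (rule squarefree_pos)
  let ?X = "{d \<in> mu_class n s. omega d < r}" and ?X' = "{d \<in> mu_class n s. \<not> omega d < r}"
  let ?Y = "{d \<in> mu_class n (-s). omega d < r}"
    and ?Y' = "{d \<in> mu_class n (-s). \<not> omega d < r} - {m, n}"
  have fin: "finite (mu_class n u)" for u by (rule finite_mu_class[OF pos])
  have "omega (n div m) = omega n - r"
    using omega_divisor_complement[OF sq m(1)] m(2) by simp
  moreover have "squarefree (n div m)" using sq m(1) squarefree_mono by (metis dvd_div_mult_self dvd_triv_left)
  \<comment> \<open>The same parity puts \<open>x^m - 1\<close> into the denominator.\<close>
  ultimately have mu_m: "mu (n div m) = - s" by (simp add: mu_def r)
  have "int m - (int (\<Sum>?X) - int (\<Sum>?Y)) \<le> int (max_gap F)"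
  proof (rule max_gap_ge_of_unity_poly_quotient)
    show "finite ?X" "finite ?Y" "finite ?X'" "finite ?Y'" using fin by auto
    show "m > 0" using m(1) pos by (simp add: dvd_pos_nat)
    show "d > 0" if "d \<in> ?X \<union> ?Y" for d using that pos by (auto simp: mu_class_def dvd_pos_nat)
    \<comment> \<open>Minimality gives only \<open>m <= d\<close>; equality is excluded because
      \<open>m\<close> is in the opposite class to \<open>?X'\<close> and was removed from
      \<open>?Y'\<close>.\<close>
    show "m < d" if "d \<in> ?X' \<union> ?Y'" for d
    proof -
      have "d dvd n" "r \<le> omega d" "d \<noteq> m" using that mu_m s by (auto simp: mu_class_def)
      thus ?thesis using m(3) by (simp add: le_neq_trans)
    qed
    show "prod unity_poly ?Y dvd prod unity_poly ?X" by (rule low_unity_poly_dvd[OF sq s r])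
    have X: "prod unity_poly (mu_class n s) = prod unity_poly ?X * prod unity_poly ?X'"
      by (subst prod.union_disjoint[symmetric]) (auto simp: fin intro!: prod.cong)
    have "m \<noteq> n" using m(2) r(1) by auto
    hence "mu_class n (-s) - {n} = ?Y \<union> insert m ?Y'" using m mu_m r(1) by (auto simp: mu_class_def)
    hence "prod unity_poly (mu_class n (-s) - {n}) = prod unity_poly (?Y \<union> insert m ?Y')" by simp
    also have "\<dots> = prod unity_poly ?Y * prod unity_poly (insert m ?Y')"
      using m(2) by (intro prod.union_disjoint) (auto simp: fin)
    also have "prod unity_poly (insert m ?Y') = unity_poly m * prod unity_poly ?Y'"
      using fin by (intro prod.insert) auto
    finally show "F * (prod unity_poly ?Y * (unity_poly m * prod unity_poly ?Y'))
        = prod unity_poly ?X * prod unity_poly ?X'"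
      using F X by simp
  qed
  \<comment> \<open>The signed divisor sum is the degree of the truncated quotient.\<close>
  moreover have "s * (\<Sum>d | d dvd n \<and> omega d < r. mu (n div d) * int d) = int (\<Sum>?X) - int (\<Sum>?Y)"
  proof -
    let ?E = "{d. d dvd n \<and> omega d < r}"
    have "finite ?E" by (rule finite_subset[of _ "{d. d dvd n}"]) (use pos in auto)
    hence "s * (\<Sum>d\<in>?E. mu (n div d) * int d)
        = (\<Sum>d | d \<in> ?E \<and> mu (n div d) = s. int d) - (\<Sum>d | d \<in> ?E \<and> mu (n div d) = - s. int d)"
      using s mu_divisor_cases[OF sq] by (intro sum_signed_split) auto
    moreover have "{d. d \<in> ?E \<and> mu (n div d) = u} = {d \<in> mu_class n u. omega d < r}" for u
      by (auto simp: mu_class_def)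
    ultimately show ?thesis by simp
  qed
  ultimately show ?thesis by simp
qed

section \<open>Ordered primes and the two bounds\<close>

text \<open>The largest index in \<open>I\<close> is at least \<open>card I\<close>, so its value is
  at least the last factor on the left; remove both and induct.\<close>

lemma prod_initial_segment_le:
  fixes p :: "nat \<Rightarrow> nat"
  assumes "strict_mono_on {1..k} p" "\<And>i. i \<in> {1..k} \<Longrightarrow> p i > 0"
  shows "I \<subseteq> {1..k} \<Longrightarrow> r \<le> card I \<Longrightarrow> (\<Prod>i=1..r. p i) \<le> (\<Prod>i\<in>I. p i)"
proof (induction r arbitrary: I)
  case 0
  thus ?case using assms(2) by (auto intro!: Suc_leI prod_pos)
next
  case (Suc r)
  have fin: "finite I" using Suc.prems(1) finite_subset by blast
  have ne: "I \<noteq> {}" using Suc.prems(2) by auto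
  define M where "M = Max I"
  have M: "M \<in> I" using fin ne by (simp add: M_def)
  have "I \<subseteq> {1..M}" using Suc.prems(1) fin by (auto simp: M_def)
  hence "card I \<le> M" using card_mono[of "{1..M}" I] by simp
  hence "p (Suc r) \<le> p M"
    using Suc.prems M assms(1) by (intro strict_mono_on_leD[of "{1..k}" p]) auto
  moreover have "(\<Prod>i=1..r. p i) \<le> (\<Prod>i\<in>I - {M}. p i)"
    using Suc.prems M fin by (intro Suc.IH) auto
  ultimately show ?case
    using prod.remove[OF fin M, of p] by (simp add: mult.commute mult_mono)
qed

text \<open>Nonnegativity of \<open>b\<close> covers the empty maximum.\<close>

lemma max_or_zero_le:
  assumes "finite A" "0 \<le> b" "\<And>a. a \<in> A \<Longrightarrow> a \<le> b"
  shows "max_or_zero A \<le> b"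
  using assms by (simp add: max_or_zero_def)

theorem theorem3:
  fixes p :: "nat \<Rightarrow> nat" and k n :: nat
  assumes "k \<ge> 1"
    and "\<And>i. i \<in> {1..k} \<Longrightarrow> prime (p i) \<and> odd (p i)"
    and "strict_mono_on {1..k} p"
    and "n = (\<Prod>i=1..k. p i)"
  shows "int (max_gap (cyclotomic n)) \<ge> gamma_plus p k n
       \<and> int (max_gap (inverse_cyclotomic n)) \<ge> gamma_minus p k n"
proof -
  have prime: "prime (p i)" if "i \<in> {1..k}" for i using assms(2) that by blast
  have inj: "inj_on p {1..k}" using assms(3) by (rule strict_mono_on_imp_inj_on)
  have sq: "squarefree n" unfolding assms(4)
  proof (rule squarefree_prod_coprime)
    show "coprime (p i) (p j)" if "i \<in> {1..k}" "j \<in> {1..k}" "i \<noteq> j" for i j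
      using that prime inj by (intro primes_coprime) (auto dest: inj_onD)
  qed (rule squarefree_prime[OF prime])
  have pf: "prime_factors (\<Prod>i=1..r. p i) = p ` {1..r}" if "r \<le> k" for r
  proof -
    have "inj_on p {1..r}" using inj_on_subset[OF inj, of "{1..r}"] that by simp
    hence "(\<Prod>i=1..r. p i) = \<Prod>(p ` {1..r})" by (simp add: prod.reindex)
    also have "prime_factors \<dots> = p ` {1..r}"
      using prime that by (intro prime_factors_prod_primes) auto
    finally show ?thesis .
  qed
  have omega: "omega (\<Prod>i=1..r. p i) = r" if "r \<le> k" for r
    using card_image[OF inj_on_subset[OF inj, of "{1..r}"]] that
    unfolding omega_def pf[OF that] by simp
  have dvd: "(\<Prod>i=1..r. p i) dvd n" if "r \<le> k" for r
    unfolding assms(4) using that by (intro prod_dvd_prod_subset) auto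
  \<comment> \<open>A divisor is the product of \<open>p\<close> over an index set of size
    \<open>omega d\<close>, so the initial segment is the smallest choice.\<close>
  have least: "(\<Prod>i=1..r. p i) \<le> d" if "d dvd n" "r \<le> omega d" for r d
  proof -
    have nz: "n \<noteq> 0" using squarefree_pos[OF sq] by simp
    define I where "I = {i \<in> {1..k}. p i \<in> prime_factors d}"
    have "prime_factors d \<subseteq> p ` {1..k}"
      using dvd_prime_factors[OF nz that(1)] pf[of k] assms(4) by simp
    hence img: "p ` I = prime_factors d" by (auto simp: I_def)
    have injI: "inj_on p I" using inj by (rule inj_on_subset) (auto simp: I_def)
    have "card I = omega d" using card_image[OF injI] img by (simp add: omega_def)
    hence "(\<Prod>i=1..r. p i) \<le> (\<Prod>i\<in>I. p i)"
      using assms(3) prime that(2) by (intro prod_initial_segment_le[of k]) (auto simp: I_def prime_gt_0_nat)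
    also have "\<dots> = \<Prod>(prime_factors d)" using prod.reindex[OF injI, of "\<lambda>x. x"] img by simp
    also have "\<dots> = d" by (rule squarefree_prod_prime_factors[OF squarefree_mono[OF that(1) sq]])
    finally show ?thesis .
  qed
  have n: "omega n = k" using omega[of k] assms(4) by simp
  \<comment> \<open>The value \<open>mu 1 = 1\<close> puts \<open>n\<close> into class 1
    only.\<close>
  have n_notin: "mu_class n (-1) - {n} = mu_class n (-1)"
    using squarefree_pos[OF sq] by (auto simp: mu_class_def mu_def omega_def)
  have plus: "int (\<Prod>i=1..r. p i) - (\<Sum>d | d dvd n \<and> omega d < r. mu (n div d) * int d)
      \<le> int (max_gap (cyclotomic n))" if "r < k" "rho (int k - int r) = -1" for r
  proof -
    \<comment> \<open>Here \<open>k - r\<close> is odd, the parity required for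
      \<open>s = 1\<close>.\<close>
    have power: "(-1) ^ (k - r) = (-1::int)" using that by (cases "even (k - r)") (auto simp: rho_def split: if_splits)
    have "int (\<Prod>i=1..r. p i) - 1 * (\<Sum>d | d dvd n \<and> omega d < r. mu (n div d) * int d)
        \<le> int (max_gap (cyclotomic n))"
    proof (rule max_gap_ge_truncated[OF sq])
      show "r < omega n" "(\<Prod>i=1..r. p i) dvd n" "omega (\<Prod>i=1..r. p i) = r"
        using n dvd omega that(1) by simp_all
      show "(-1) ^ (omega n - r) = - (1 :: int)" using power n by simp
      show "(\<Prod>i=1..r. p i) \<le> d" if "d dvd n" "r \<le> omega d" for d
        using that by (rule least)
      show "cyclotomic n * prod unity_poly (mu_class n (- 1) - {n}) = prod unity_poly (mu_class n 1)"
        unfolding n_notin by (rule cyclotomic_unity_poly[OF sq])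
    qed simp
    thus ?thesis by simp
  qed
  have minus: "int (\<Prod>i=1..r. p i) + (\<Sum>d | d dvd n \<and> omega d < r. mu (n div d) * int d)
      \<le> int (max_gap (inverse_cyclotomic n))" if "r < k" "rho (int k - int r) = 1" for r
  proof -
    \<comment> \<open>Here \<open>k - r\<close> is even, the parity required for
      \<open>s = -1\<close>.\<close>
    have power: "(-1) ^ (k - r) = (1::int)" using that by (cases "even (k - r)") (auto simp: rho_def split: if_splits)
    have "int (\<Prod>i=1..r. p i) - (-1) * (\<Sum>d | d dvd n \<and> omega d < r. mu (n div d) * int d)
        \<le> int (max_gap (inverse_cyclotomic n))"
    proof (rule max_gap_ge_truncated[OF sq])
      show "r < omega n" "(\<Prod>i=1..r. p i) dvd n" "omega (\<Prod>i=1..r. p i) = r"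
        using n dvd omega that(1) by simp_all
      show "(-1) ^ (omega n - r) = - ((-1) :: int)" using power n by simp
      show "(\<Prod>i=1..r. p i) \<le> d" if "d dvd n" "r \<le> omega d" for d
        using that by (rule least)
      show "inverse_cyclotomic n * prod unity_poly (mu_class n (- (- 1)) - {n}) = prod unity_poly (mu_class n (- 1))"
        using inverse_cyclotomic_unity_poly[OF sq] by simp
    qed simp
    thus ?thesis by simp
  qed
  have "gamma_plus p k n \<le> int (max_gap (cyclotomic n))"
    unfolding gamma_plus_def
  proof (rule max_or_zero_le)
    show "finite {int (\<Prod>i=1..r. p i) - (\<Sum>d | d dvd n \<and> omega d < r. mu (n div d) * int d)
      | r. 1 \<le> r \<and> r < k \<and> rho (int k - int r) = -1}"
      by (rule finite_image_set) simp
  qed (use plus in \<open>simp, blast\<close>)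
  moreover have "gamma_minus p k n \<le> int (max_gap (inverse_cyclotomic n))"
    unfolding gamma_minus_def
  proof (rule max_or_zero_le)
    show "finite {int (\<Prod>i=1..r. p i) + (\<Sum>d | d dvd n \<and> omega d < r. mu (n div d) * int d)
      | r. 1 \<le> r \<and> r < k \<and> rho (int k - int r) = 1}"
      by (rule finite_image_set) simp
  qed (use minus in \<open>simp, blast\<close>)
  ultimately show ?thesis by simp
qed

end
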